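(* Let $x,q\in\mathbb{C}$. For every integer $n\ge1$ (such that $\det M_n(x|q)\ne0$, so that the quotient is defined), $$\frac{\det M_{n+1}(x|q)}{\det M_n(x|q)}=(-1)^n\,q^{n(n-1)/2}\,[n]_q!.$$
   Context: Notation: $[n]_q=1+q+\dots+q^{n-1}$, $[0]_q=0$; $[n]_q!=[1]_q[2]_q\cdots[n]_q$. The convention $q^0=1$ is used also for $q=0$. The (renormalized) continuous $q$-Hermite polynomials $H_n(x|q)$ are defined by $H_{-1}=0$, $H_0=1$ and $H_{n+1}(x)=xH_n(x)-[n]_qH_{n-1}(x)$ for $n\ge0$. $M_n(x|q)=[H_{i+j}(x|q)]_{i,j=0,\dots,n-1}$ denotes the $n\times n$ Hankel matrix formed from the $q$-Hermite polynomials. *)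

theory Defs
  imports Complex_Main "Jordan_Normal_Form.Determinant"
begin

definition q_number :: "complex \<Rightarrow> nat \<Rightarrow> complex" where
  "q_number q n = (\<Sum>k<n. q ^ k)"

definition q_fact :: "complex \<Rightarrow> nat \<Rightarrow> complex" where
  "q_fact q n = (\<Prod>k = 1..n. q_number q k)"

text \<open>
  The recurrence is \<open>H\<^sub>m\<^sub>+\<^sub>1 = x H\<^sub>m - [m]\<^sub>q H\<^sub>m\<^sub>-\<^sub>1\<close> for all \<open>m\<close> from 0 on, with
  \<open>H\<^sub>-\<^sub>1 = 0\<close> and \<open>H\<^sub>0 = 1\<close>. Indices here are natural numbers, so the instance
  \<open>m = 0\<close>, where the \<open>H\<^sub>-\<^sub>1\<close> term vanishes, is the second equation; the third is
  the instance \<open>m = n + 1\<close>.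
\<close>

fun q_hermite :: "nat \<Rightarrow> complex \<Rightarrow> complex \<Rightarrow> complex" where
  "q_hermite 0 x q = 1"
| "q_hermite (Suc 0) x q = x"
| "q_hermite (Suc (Suc n)) x q =
     x * q_hermite (Suc n) x q - q_number q (Suc n) * q_hermite n x q"

definition q_hermite_hankel :: "nat \<Rightarrow> complex \<Rightarrow> complex \<Rightarrow> complex mat" where
  "q_hermite_hankel n x q = mat n n (\<lambda>(i, j). q_hermite (i + j) x q)"

end

(* The Hankel matrix factors as L D L^T, where L is lower unitriangular with entries
   L i k = [i choose k]_q H_(i-k) and D is diagonal with entries
   d k = (-1)^k q^(k(k-1)/2) [k]_q!. By the q-Pascal rule the rows of L obey a three-term
   recurrence L (i+1) k = L i (k-1) + q^k x L i k + (d (k+1) / d k) L i (k+1), i.e. multiplication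
   by a tridiagonal matrix that is symmetric with respect to D. Hence S i j = (SUM k. d k L i k L j k)
   satisfies S (i+1) j = S i (j+1), so that S i j = S 0 (i+j) = H_(i+j). *)

theory Submission
  imports Defs
begin

lemma q_number_0 [simp]: "q_number q 0 = 0"
  by (simp add: q_number_def)

lemma q_number_Suc: "q_number q (Suc n) = q_number q n + q ^ n"
  by (simp add: q_number_def)

lemma q_number_add: "q_number q (m + n) = q_number q m + q ^ m * q_number q n"
  by (induction n) (simp_all add: q_number_Suc power_add algebra_simps)

text \<open>The q-Pascal rule serves as the definition: the quotient of q-factorials is undefined
  when \<open>q\<close> is a root of unity other than 1, where some \<open>q_number\<close>
  vanishes.\<close>

fun q_binomial :: "complex \<Rightarrow> nat \<Rightarrow> nat \<Rightarrow> complex" where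
  "q_binomial q n 0 = 1"
| "q_binomial q 0 (Suc k) = 0"
| "q_binomial q (Suc n) (Suc k) = q_binomial q n k + q ^ Suc k * q_binomial q n (Suc k)"

lemma q_binomial_eq_0: "n < k \<Longrightarrow> q_binomial q n k = 0"
  by (induction q n k rule: q_binomial.induct) auto

lemma q_binomial_self [simp]: "q_binomial q n n = 1"
  by (induction n) (simp_all add: q_binomial_eq_0)

text \<open>Used to trade the coefficient \<open>q_number q (n - k)\<close> produced by the Hermite
  recurrence for one that depends only on the column index.\<close>

lemma q_binomial_absorb:
  assumes "k \<le> n"
  shows "q_number q (Suc k) * q_binomial q n (Suc k) = q_number q (n - k) * q_binomial q n k"
  using assms
proof (induction n arbitrary: k)
  case 0
  then show ?case by simp
next
  case (Suc n)
  show ?case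
  proof (cases "k = Suc n")
    case True
    then show ?thesis by (simp add: q_binomial_eq_0)
  next
    case False
    then have k: "k \<le> n"
      using Suc.prems by simp
    \<comment> \<open>Both sides reduce to \<open>q_number q (Suc n) * q_binomial q n k\<close>: the
      left by the induction hypothesis at \<open>k\<close>, the right by the one at
      \<open>k - 1\<close> when \<open>k > 0\<close>.\<close>
    have "q_number q (Suc k) * q_binomial q (Suc n) (Suc k)
        = (q_number q (Suc k) + q ^ Suc k * q_number q (n - k)) * q_binomial q n k"
      using Suc.IH[OF k] by (simp add: algebra_simps)
    also have "\<dots> = q_number q (Suc n) * q_binomial q n k"
      using q_number_add[of q "Suc k" "n - k"] k by simp
    also have "\<dots> = q_number q (Suc n - k) * q_binomial q (Suc n) k"
    proof (cases k)
      case (Suc l)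
      have "q_number q (Suc n - k) * q_binomial q (Suc n) k
          = q_number q (n - l) * q_binomial q n l
            + q ^ k * q_number q (Suc n - k) * q_binomial q n k"
        using Suc by (simp add: algebra_simps)
      also have "q_number q (n - l) * q_binomial q n l = q_number q k * q_binomial q n k"
        using Suc.IH[of l] Suc k by simp
      also have "q_number q k * q_binomial q n k + q ^ k * q_number q (Suc n - k) * q_binomial q n k
          = q_number q (k + (Suc n - k)) * q_binomial q n k"
        by (simp only: q_number_add distrib_right)
      also have "k + (Suc n - k) = Suc n"
        using k by simp
      finally show ?thesis by simp
    qed simp
    finally show ?thesis .
  qed
qed

definition hankel_factor :: "complex \<Rightarrow> complex \<Rightarrow> nat \<Rightarrow> nat \<Rightarrow> complex" where
  "hankel_factor x q i k = q_binomial q i k * q_hermite (i - k) x q"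

definition hankel_pivot :: "complex \<Rightarrow> nat \<Rightarrow> complex" where
  "hankel_pivot q k = (-1) ^ k * q ^ (k * (k - 1) div 2) * q_fact q k"

lemma hankel_factor_eq_0: "i < k \<Longrightarrow> hankel_factor x q i k = 0"
  by (simp add: hankel_factor_def q_binomial_eq_0)

lemma hankel_factor_self [simp]: "hankel_factor x q i i = 1"
  by (simp add: hankel_factor_def)

lemma hankel_factor_0_right: "hankel_factor x q i 0 = q_hermite i x q"
  by (simp add: hankel_factor_def)

lemma hankel_pivot_0 [simp]: "hankel_pivot q 0 = 1"
  by (simp add: hankel_pivot_def q_fact_def)

text \<open>The exponent grows by \<open>k\<close>, a difference of triangular numbers. The product
  form of the ratio stays meaningful when a pivot vanishes.\<close>

lemma hankel_pivot_Suc: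
  "hankel_pivot q (Suc k) = - (q ^ k * q_number q (Suc k)) * hankel_pivot q k"
proof -
  have "Suc k * k div 2 = k * (k - 1) div 2 + k"
  proof (cases k)
    case (Suc l)
    have "Suc k * k = k * (k - 1) + k * 2"
      using Suc by (simp add: algebra_simps)
    then show ?thesis by simp
  qed simp
  then show ?thesis
    by (simp add: hankel_pivot_def q_fact_def power_add algebra_simps)
qed

text \<open>At \<open>m = 0\<close> the truncated index \<open>m - 1\<close> is harmless, because
  its coefficient \<open>q_number q 0\<close> is zero.\<close>

lemma q_hermite_Suc:
  "q_hermite (Suc m) x q = x * q_hermite m x q - q_number q m * q_hermite (m - 1) x q"
  by (cases m) simp_all

text \<open>For \<open>k \<le> i\<close> this is the Hermite recurrence at \<open>i - k\<close>,
  with absorption moving its last term to column \<open>k + 1\<close>; for \<open>k > i\<close> both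
  sides vanish.\<close>

lemma q_binomial_mult_q_hermite:
  "q_binomial q i k * q_hermite (Suc i - k) x q
    = x * hankel_factor x q i k - q_number q (Suc k) * hankel_factor x q i (Suc k)"
proof (cases "k \<le> i")
  case True
  have "q_binomial q i k * q_hermite (Suc i - k) x q
      = x * hankel_factor x q i k
        - q_number q (i - k) * q_binomial q i k * q_hermite (i - Suc k) x q"
    using True by (simp add: hankel_factor_def Suc_diff_le q_hermite_Suc algebra_simps)
  then show ?thesis
    by (simp only: q_binomial_absorb[OF True, symmetric] hankel_factor_def mult.assoc)
qed (simp add: hankel_factor_eq_0 q_binomial_eq_0)

lemma hankel_factor_Suc_0:
  "hankel_factor x q (Suc i) 0 = x * hankel_factor x q i 0 - hankel_factor x q i 1"
  using q_binomial_mult_q_hermite[of q i 0 x]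
  by (simp add: hankel_factor_def q_number_Suc)

text \<open>The q-Pascal rule splits the entry in two; as \<open>Suc i - Suc k = i - k\<close>, the
  second part is the preceding expansion at column \<open>Suc k\<close>.\<close>

lemma hankel_factor_Suc_Suc:
  "hankel_factor x q (Suc i) (Suc k) = hankel_factor x q i k
    + q ^ Suc k * (x * hankel_factor x q i (Suc k)
        - q_number q (Suc (Suc k)) * hankel_factor x q i (Suc (Suc k)))"
  unfolding q_binomial_mult_q_hermite[symmetric]
  by (simp add: hankel_factor_def algebra_simps)

(* The first two sums are symmetric in i and j; the last summand vanishes for i <= n. *)
lemma sum_hankel_factor_Suc:
  "(\<Sum>k\<le>n. hankel_pivot q k * hankel_factor x q (Suc i) k * hankel_factor x q j k)
    = (\<Sum>k\<le>n. x * q ^ k * hankel_pivot q k * hankel_factor x q i k * hankel_factor x q j k)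
    + (\<Sum>k<n. hankel_pivot q (Suc k)
        * (hankel_factor x q i k * hankel_factor x q j (Suc k)
          + hankel_factor x q i (Suc k) * hankel_factor x q j k))
    + hankel_pivot q (Suc n) * hankel_factor x q i (Suc n) * hankel_factor x q j n"
proof (induction n)
  case 0
  show ?case
    by (simp add: hankel_factor_Suc_0 hankel_pivot_Suc q_number_Suc algebra_simps)
next
  case (Suc n)
  show ?case
    \<comment> \<open>The old boundary term completes the symmetric summand at \<open>k = n\<close>,
      and the \<open>q_number q (Suc (Suc n))\<close> term of the recurrence becomes the new one.
      Only the top pivot is expanded, so that \<open>hankel_pivot q (Suc n)\<close> remains a common
      factor.\<close>
    unfolding sum.atMost_Suc sum.lessThan_Suc Suc.IH hankel_factor_Suc_Suc
      hankel_pivot_Suc[of q "Suc n"]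
    by (simp add: algebra_simps)
qed

text \<open>Each induction step moves one unit from \<open>i\<close> to \<open>j\<close>; this
  preserves \<open>i + j\<close>, hence also the bound by the fixed \<open>n\<close>.\<close>

lemma q_hermite_add:
  assumes "i + j \<le> n"
  shows "q_hermite (i + j) x q
    = (\<Sum>k\<le>n. hankel_pivot q k * hankel_factor x q i k * hankel_factor x q j k)"
  using assms
proof (induction i arbitrary: j)
  case 0
  have "(\<Sum>k\<le>n. hankel_pivot q k * hankel_factor x q 0 k * hankel_factor x q j k)
      = (\<Sum>k\<in>{0}. hankel_pivot q k * hankel_factor x q 0 k * hankel_factor x q j k)"
    by (rule sum.mono_neutral_right) (auto simp: hankel_factor_eq_0)
  then show ?case by (simp add: hankel_factor_0_right)
next
  case (Suc i)
  \<comment> \<open>Both sides have the same symmetric part, and both boundary terms vanish since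
    \<open>i\<close> and \<open>j\<close> are at most \<open>n\<close>.\<close>
  have "(\<Sum>k\<le>n. hankel_pivot q k * hankel_factor x q (Suc i) k * hankel_factor x q j k)
      = (\<Sum>k\<le>n. hankel_pivot q k * hankel_factor x q (Suc j) k * hankel_factor x q i k)"
    using Suc.prems unfolding sum_hankel_factor_Suc
    by (simp add: hankel_factor_eq_0 ac_simps)
  then show ?case
    using Suc.IH[of "Suc j"] Suc.prems by (simp add: ac_simps)
qed

lemma q_hermite_hankel_decomp:
  "q_hermite_hankel n x q
    = mat n n (\<lambda>(i, k). hankel_factor x q i k)
      * (mat n n (\<lambda>(i, k). if i = k then hankel_pivot q k else 0)
        * transpose_mat (mat n n (\<lambda>(i, k). hankel_factor x q i k)))"
proof (rule eq_matI)
  fix i j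
  assume "i < dim_row (mat n n (\<lambda>(i, k). hankel_factor x q i k)
      * (mat n n (\<lambda>(i, k). if i = k then hankel_pivot q k else 0)
        * transpose_mat (mat n n (\<lambda>(i, k). hankel_factor x q i k))))"
    and "j < dim_col (mat n n (\<lambda>(i, k). hankel_factor x q i k)
      * (mat n n (\<lambda>(i, k). if i = k then hankel_pivot q k else 0)
        * transpose_mat (mat n n (\<lambda>(i, k). hankel_factor x q i k))))"
  then have ij: "i < n" "j < n" by simp_all
  \<comment> \<open>The limit \<open>i + j + n\<close> satisfies the bound and covers all columns
    below \<open>n\<close>; the summands with \<open>k \<ge> n\<close> vanish because
    \<open>i < n\<close>.\<close>
  have "q_hermite (i + j) x q
      = (\<Sum>k\<le>i + j + n. hankel_pivot q k * hankel_factor x q i k * hankel_factor x q j k)"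
    by (rule q_hermite_add) simp
  also have "\<dots> = (\<Sum>k\<in>{0..<n}. hankel_pivot q k * hankel_factor x q i k * hankel_factor x q j k)"
    using ij by (intro sum.mono_neutral_right) (auto simp: hankel_factor_eq_0)
  finally show "q_hermite_hankel n x q $$ (i, j)
      = (mat n n (\<lambda>(i, k). hankel_factor x q i k)
        * (mat n n (\<lambda>(i, k). if i = k then hankel_pivot q k else 0)
          * transpose_mat (mat n n (\<lambda>(i, k). hankel_factor x q i k)))) $$ (i, j)"
    using ij by (simp add: q_hermite_hankel_def scalar_prod_def if_distrib[of "(*) _"]
        ac_simps cong: if_cong)
qed (simp_all add: q_hermite_hankel_def)

lemma det_q_hermite_hankel: "det (q_hermite_hankel n x q) = (\<Prod>k<n. hankel_pivot q k)"
proof -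
  define L where "L = mat n n (\<lambda>(i, k). hankel_factor x q i k)"
  define D where "D = mat n n (\<lambda>(i, k). if i = k then hankel_pivot q k else 0)"
  have carrier: "L \<in> carrier_mat n n" "D \<in> carrier_mat n n"
    by (simp_all add: L_def D_def)
  have "det L = 1"
    using det_lower_triangular[OF _ carrier(1)]
    by (simp add: L_def hankel_factor_eq_0 prod_list_diag_prod)
  moreover have "det D = (\<Prod>k<n. hankel_pivot q k)"
    using det_lower_triangular[OF _ carrier(2)]
    by (simp add: D_def prod_list_diag_prod atLeast0LessThan)
  ultimately show ?thesis
    unfolding q_hermite_hankel_decomp L_def[symmetric] D_def[symmetric]
    using carrier by (simp add: det_mult[where n = n] det_transpose[where n = n])
qed

theorem theorem3:
  fixes x q :: complex and n :: nat
  assumes "n \<ge> 1"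
    and "det (q_hermite_hankel n x q) \<noteq> 0"
  shows "det (q_hermite_hankel (n + 1) x q) / det (q_hermite_hankel n x q)
         = (-1) ^ n * q ^ (n * (n - 1) div 2) * q_fact q n"
  \<comment> \<open>The two products differ by the single pivot at \<open>n\<close>; the nonzero
    determinant permits cancelling the rest.\<close>
  using assms(2) by (simp add: det_q_hermite_hankel hankel_pivot_def)

end
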